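(* $\mathrm{Rs}(K_3,K_{1,3})=29$.
   Context: All graphs are finite and simple. A (not necessarily induced) subgraph $H$ of a host graph $F$ is singular if the degrees $d_F(v)$, $v\in V(H)$, taken in $F$, are all equal or pairwise distinct. In an edge 2-coloring of $K_m$, the host graph of a color is the spanning graph on all $m$ vertices formed by the edges of that color. $\mathrm{Rs}(G_1,G_2)$ is the smallest integer $N$ such that for every $m\ge N$ and every 2-coloring of the edges of $K_m$, the graph of color 1 contains a singular subgraph isomorphic to $G_1$ or the graph of color 2 contains a singular subgraph isomorphic to $G_2$. *)

theory Defs
  imports "HOL-Library.Ramsey"
begin

type_synonym 'a graph = "'a set \<times> 'a set set"

abbreviation verts :: "'a graph \<Rightarrow> 'a set" where "verts G \<equiv> fst G"
abbreviation edges :: "'a graph \<Rightarrow> 'a set set" where "edges G \<equiv> snd G"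

definition simple_graph :: "'a graph \<Rightarrow> bool" where
  "simple_graph G \<longleftrightarrow> finite (verts G) \<and> edges G \<subseteq> nsets (verts G) 2"

definition degree :: "'a graph \<Rightarrow> 'a \<Rightarrow> nat" where
  "degree G v = card {e \<in> edges G. v \<in> e}"

definition subgraph :: "'a graph \<Rightarrow> 'a graph \<Rightarrow> bool" where
  "subgraph H F \<longleftrightarrow> simple_graph H \<and> verts H \<subseteq> verts F \<and> edges H \<subseteq> edges F"

definition isomorphic :: "'a graph \<Rightarrow> 'b graph \<Rightarrow> bool" where
  "isomorphic G H \<longleftrightarrow> (\<exists>f. bij_betw f (verts G) (verts H) \<and>
     (\<forall>u \<in> verts G. \<forall>v \<in> verts G. {u, v} \<in> edges G \<longleftrightarrow> {f u, f v} \<in> edges H))"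

definition complete_graph :: "nat \<Rightarrow> nat graph" where
  "complete_graph m = ({..<m}, nsets {..<m} 2)"

definition complete_bipartite :: "nat \<Rightarrow> nat \<Rightarrow> nat graph" where
  "complete_bipartite a b = ({..<a + b}, {{i, j} | i j. i < a \<and> a \<le> j \<and> j < a + b})"

(* All degrees are degrees in the host graph F, not in H. *)
definition singular :: "'a graph \<Rightarrow> 'a graph \<Rightarrow> bool" where
  "singular F H \<longleftrightarrow>
     (\<forall>u \<in> verts H. \<forall>v \<in> verts H. degree F u = degree F v) \<or>
     (\<forall>u \<in> verts H. \<forall>v \<in> verts H. u \<noteq> v \<longrightarrow> degree F u \<noteq> degree F v)"

definition contains_singular :: "'a graph \<Rightarrow> 'b graph \<Rightarrow> bool" where
  "contains_singular F G \<longleftrightarrow> (\<exists>H. subgraph H F \<and> singular F H \<and> isomorphic G H)"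

definition host_graph :: "nat \<Rightarrow> (nat set \<Rightarrow> nat) \<Rightarrow> nat \<Rightarrow> nat graph" where
  "host_graph m c i = ({..<m}, {e \<in> edges (complete_graph m). c e = i})"

definition singular_ramsey_property :: "'a graph \<Rightarrow> 'b graph \<Rightarrow> nat \<Rightarrow> bool" where
  "singular_ramsey_property G1 G2 N \<longleftrightarrow>
     (\<forall>m \<ge> N. \<forall>c \<in> edges (complete_graph m) \<rightarrow> {1, 2}.
        contains_singular (host_graph m c 1) G1 \<or> contains_singular (host_graph m c 2) G2)"

definition Rs :: "'a graph \<Rightarrow> 'b graph \<Rightarrow> nat" where
  "Rs G1 G2 = (LEAST N. singular_ramsey_property G1 G2 N)"

(* The remaining facts show that the minimum in the definition of Rs ranges over a nonempty
   set, so that LEAST never takes an unspecified value on simple graphs. *)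

lemma constant_or_injective_subset:
  fixes f :: "'a \<Rightarrow> 'b"
  assumes "finite S" "card S > k * k"
  shows "\<exists>T \<subseteq> S. card T = k \<and> ((\<forall>u\<in>T. \<forall>v\<in>T. f u = f v) \<or> inj_on f T)"
proof (cases "k \<le> card (f ` S)")
  case True
  then obtain D where D: "D \<subseteq> f ` S" "card D = k"
    by (meson obtain_subset_with_card_n)
  then obtain T where "T \<subseteq> S" "inj_on f T" "D = f ` T"
    by (auto simp: subset_image_inj)
  then show ?thesis using D by (metis card_image)
next
  case False
  have "\<exists>y \<in> f ` S. k \<le> card {x \<in> S. f x = y}"
  proof (rule ccontr)
    assume "\<not> ?thesis"
    then have "(\<Sum>y \<in> f ` S. card {x \<in> S. f x = y}) \<le> card (f ` S) * k"
      by (intro sum_bounded_above[where K = k, simplified]) auto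
    moreover have "card S = (\<Sum>y \<in> f ` S. card {x \<in> S. f x = y})"
      using assms(1) by (subst card_UN_disjoint[symmetric]) (auto intro: arg_cong[where f = card])
    moreover have "card (f ` S) * k \<le> k * k"
      using False by simp
    ultimately show False using assms(2) by linarith
  qed
  then obtain y T where "T \<subseteq> {x \<in> S. f x = y}" "card T = k"
    by (meson obtain_subset_with_card_n)
  then show ?thesis by (intro exI[of _ T]) auto
qed

lemma contains_singular_if_large_clique:
  fixes G :: "'a graph" and F :: "'b graph"
  assumes G: "simple_graph G" and k: "k = card (verts G)"
    and R: "R \<subseteq> verts F" "finite R" "card R > k * k" "nsets R 2 \<subseteq> edges F"
  shows "contains_singular F G"
proof -
  obtain T where T: "T \<subseteq> R" "card T = k"
    and deg: "(\<forall>u\<in>T. \<forall>v\<in>T. degree F u = degree F v) \<or> inj_on (degree F) T"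
    using constant_or_injective_subset[OF R(2,3)] by blast
  have "finite T" using T(1) R(2) by (rule finite_subset)
  then obtain f where f: "bij_betw f (verts G) T"
    using G k T(2) by (metis simple_graph_def finite_same_card_bij)
  have inj: "inj_on f (verts G)" and im: "f ` verts G = T"
    using f by (auto simp: bij_betw_def)
  let ?H = "(T, (`) f ` edges G)"
  have E: "e \<subseteq> verts G \<and> finite e \<and> card e = 2" if "e \<in> edges G" for e
    using G that by (auto simp: simple_graph_def nsets_def)
  have HE: "(`) f ` edges G \<subseteq> nsets T 2"
  proof
    fix d assume "d \<in> (`) f ` edges G"
    then obtain e where e: "e \<in> edges G" "d = f ` e" by blast
    then have "card d = 2" using E inj by (metis card_image inj_on_subset)
    moreover have "d \<subseteq> T" "finite d" using e E im by blast+
    ultimately show "d \<in> nsets T 2" by (simp add: nsets_def)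
  qed
  have "(`) f ` edges G \<subseteq> edges F"
    using HE nsets_mono[OF T(1)] R(4) by (meson order_trans)
  then have sub: "subgraph ?H F"
    using HE \<open>finite T\<close> T(1) R(1) by (simp add: subgraph_def simple_graph_def)
  have "singular F ?H"
    using deg by (auto simp: singular_def inj_on_def)
  moreover have "{u, v} \<in> edges G \<longleftrightarrow> {f u, f v} \<in> (`) f ` edges G"
    if uv: "u \<in> verts G" "v \<in> verts G" for u v
  proof
    assume "{u, v} \<in> edges G"
    then show "{f u, f v} \<in> (`) f ` edges G" by (rule rev_image_eqI) simp
  next
    assume "{f u, f v} \<in> (`) f ` edges G"
    then obtain e where e: "e \<in> edges G" "f ` {u, v} = f ` e" by auto
    then have "{u, v} = e"
      using E[OF e(1)] uv inj by (subst (asm) inj_on_image_eq_iff) auto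
    with e show "{u, v} \<in> edges G" by simp
  qed
  then have "isomorphic G ?H"
    using f by (auto simp: isomorphic_def)
  ultimately show ?thesis
    using sub by (auto simp: contains_singular_def)
qed

lemma singular_ramsey_property_ex:
  assumes G1: "simple_graph G1" and G2: "simple_graph G2"
  shows "\<exists>N. singular_ramsey_property G1 G2 N"
proof -
  define k1 where "k1 = card (verts G1)"
  define k2 where "k2 = card (verts G2)"
  obtain r where r: "\<And>(V :: nat set) E. finite V \<Longrightarrow> card V \<ge> r \<Longrightarrow>
      \<exists>R \<subseteq> V. card R = Suc (k1 * k1) \<and> clique R E \<or> card R = Suc (k2 * k2) \<and> indep R E"
    using ramsey2[where 'a = nat] by metis
  have "contains_singular (host_graph m c 1) G1 \<or> contains_singular (host_graph m c 2) G2"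
    if m: "m \<ge> r" and c: "c \<in> edges (complete_graph m) \<rightarrow> {1, 2}" for m c
  proof -
    obtain R where R: "R \<subseteq> {..<m}"
      and alt: "card R = Suc (k1 * k1) \<and> clique R {e. c e = 1} \<or>
                card R = Suc (k2 * k2) \<and> indep R {e. c e = 1}"
      using r[of "{..<m}" "{e. c e = 1}"] m by auto
    have fin: "finite R" using R by (rule finite_subset) simp
    have c12: "c e = 1 \<or> c e = 2" if "e \<in> nsets R 2" for e
      using c that nsets_mono[OF R] by (force simp: complete_graph_def)
    have sub: "nsets R 2 \<subseteq> nsets {..<m} 2" by (rule nsets_mono[OF R])
    from alt show ?thesis
    proof
      assume *: "card R = Suc (k1 * k1) \<and> clique R {e. c e = 1}"
      then have "c e = 1" if "e \<in> nsets R 2" for e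
        using that by (auto simp: clique_def elim!: nsets2_E)
      then have "nsets R 2 \<subseteq> edges (host_graph m c 1)"
        using sub by (auto simp: host_graph_def complete_graph_def)
      then show ?thesis
        using contains_singular_if_large_clique[OF G1 k1_def, of R "host_graph m c 1"] R fin *
        by (simp add: host_graph_def)
    next
      assume *: "card R = Suc (k2 * k2) \<and> indep R {e. c e = 1}"
      then have "c e = 2" if "e \<in> nsets R 2" for e
        using that c12[OF that] by (auto simp: indep_def elim!: nsets2_E)
      then have "nsets R 2 \<subseteq> edges (host_graph m c 2)"
        using sub by (auto simp: host_graph_def complete_graph_def)
      then show ?thesis
        using contains_singular_if_large_clique[OF G2 k2_def, of R "host_graph m c 2"] R fin *
        by (simp add: host_graph_def)
    qed
  qed
  then show ?thesis by (auto simp: singular_ramsey_property_def)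
qed

lemma simple_complete_graph: "simple_graph (complete_graph m)"
  by (simp add: simple_graph_def complete_graph_def)

lemma simple_complete_bipartite: "simple_graph (complete_bipartite a b)"
  by (auto simp: simple_graph_def complete_bipartite_def)

end

theory Submission
  imports Defs
begin

text \<open>
  Call colour 1 red and colour 2 blue. The two degrees of a vertex add up to \<open>m - 1\<close>, so the two host
  graphs have the same degree classes, and a subgraph is singular in either of them iff its vertices
  lie in a single class or in pairwise different classes (are a transversal).

  If \<open>S\<close> is a set on which the degree is constant or injective, and there is no singular red triangle
  and no singular blue claw, then every vertex of \<open>S\<close> has at most two blue neighbours in \<open>S\<close>, and at
  most three red ones, because the red neighbours form a blue clique. Hence \<open>|S| \<le> 6\<close>. For \<open>S\<close> a
  class this bounds the sizes of the classes, for \<open>S\<close> a transversal it bounds their number: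
  six classes of at most six vertices each. So on 29 or more vertices there are five or six classes.

  With six classes every transversal spans two blue triangles joined by red edges, and this pattern
  is the same for all transversals. Degrees can then be computed from the class sizes, and the fact
  that different classes have different degrees limits the total to 28 (\<open>six_classes\<close>).

  With five classes there are two disjoint pairs of classes that are completely blue. Either all
  edges between the two pairs are red, and then each vertex of the fifth class is joined in blue to
  exactly one of the pairs (\<open>five_classes_split\<close>), or the colouring is a blow-up of the blue
  5-cycle (\<open>five_classes_cycle\<close>). A class of size 6 induces two blue triangles, so its degree is
  determined by its blue surroundings, and if at most one vertex is missing from five classes of size
  six, two classes end up with the same degree.

  A colouring of \<open>K\<^sub>2\<^sub>8\<close> without singular subgraphs is of the split kind with class sizes
  6, 5, 6, 5, 6, the fifth class being divided into two vertices that join the first pair and four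
  that join the second; the blue degrees are 9, 10, 11, 12, 13.
\<close>

section \<open>Singular triangles and claws\<close>

definition constant_or_injective :: "('a \<Rightarrow> 'b) \<Rightarrow> 'a set \<Rightarrow> bool" where
  "constant_or_injective f S \<longleftrightarrow> (\<forall>u\<in>S. \<forall>v\<in>S. f u = f v) \<or> inj_on f S"

lemma constant_or_injective_mono:
  "constant_or_injective f S \<Longrightarrow> T \<subseteq> S \<Longrightarrow> constant_or_injective f T"
  unfolding constant_or_injective_def by (meson inj_on_subset subsetD)

text \<open>Replaces the copy of \<open>G\<close> and the isomorphism by a single injective map, so that small graphs can be
  handled by naming the images of their vertices.\<close>

lemma contains_singular_iff_embedding:
  assumes G: "simple_graph G"
  shows "contains_singular F G \<longleftrightarrow> (\<exists>f. inj_on f (verts G) \<and> f ` verts G \<subseteq> verts F \<and>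
    (\<forall>e\<in>edges G. f ` e \<in> edges F) \<and> constant_or_injective (degree F) (f ` verts G))"
    (is "_ \<longleftrightarrow> (\<exists>f. ?emb f)")
proof
  assume "contains_singular F G"
  then obtain H f where H: "subgraph H F" "singular F H" and f: "bij_betw f (verts G) (verts H)"
    and iso: "\<And>u v. u \<in> verts G \<Longrightarrow> v \<in> verts G \<Longrightarrow> {u, v} \<in> edges G \<longleftrightarrow> {f u, f v} \<in> edges H"
    unfolding contains_singular_def isomorphic_def by blast
  have im: "f ` verts G = verts H" and inj: "inj_on f (verts G)"
    using f by (auto simp: bij_betw_def)
  have "f ` e \<in> edges F" if e: "e \<in> edges G" for e
  proof -
    have "e \<in> nsets (verts G) 2" using G e by (auto simp: simple_graph_def)
    then obtain u v where uv: "e = {u, v}" "u \<in> verts G" "v \<in> verts G"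
      by (auto elim!: nsets2_E)
    then show ?thesis using iso[of u v] e H(1) by (auto simp: subgraph_def)
  qed
  moreover have "constant_or_injective (degree F) (verts H)"
    using H(2) by (auto simp: singular_def constant_or_injective_def inj_on_def)
  ultimately have "?emb f" using im inj H(1) by (simp add: subgraph_def)
  then show "\<exists>f. ?emb f" by blast
next
  assume "\<exists>f. ?emb f"
  then obtain f where f: "inj_on f (verts G)" "f ` verts G \<subseteq> verts F"
    "\<forall>e\<in>edges G. f ` e \<in> edges F" "constant_or_injective (degree F) (f ` verts G)" by blast
  let ?H = "(f ` verts G, (`) f ` edges G)"
  have E: "e \<subseteq> verts G" "finite e" "card e = 2" if "e \<in> edges G" for e
    using G that by (auto simp: simple_graph_def nsets_def)
  have "subgraph ?H F"
    unfolding subgraph_def simple_graph_def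
  proof (intro conjI)
    show "finite (verts ?H)" using G by (simp add: simple_graph_def)
    show "edges ?H \<subseteq> nsets (verts ?H) 2"
    proof
      fix d assume "d \<in> edges ?H"
      then obtain e where e: "e \<in> edges G" "d = f ` e" by auto
      moreover have "card (f ` e) = 2" using E[OF e(1)] f(1) by (metis card_image inj_on_subset)
      ultimately show "d \<in> nsets (verts ?H) 2" using E[OF e(1)] by (auto simp: nsets_def)
    qed
  qed (use f(2,3) in auto)
  moreover have "singular F ?H"
    using f(4) by (auto simp: singular_def constant_or_injective_def inj_on_def)
  moreover have "{u, v} \<in> edges G \<longleftrightarrow> {f u, f v} \<in> (`) f ` edges G"
    if uv: "u \<in> verts G" "v \<in> verts G" for u v
  proof
    assume "{f u, f v} \<in> (`) f ` edges G"
    then obtain e where e: "e \<in> edges G" "f ` {u, v} = f ` e" by auto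
    then have "{u, v} = e"
      using inj_on_image_eq_iff[OF f(1), of "{u, v}" e] E(1)[OF e(1)] uv by auto
    with e show "{u, v} \<in> edges G" by simp
  qed (rule rev_image_eqI, auto)
  then have "isomorphic G ?H"
    using f(1) by (auto simp: isomorphic_def bij_betw_def)
  ultimately show "contains_singular F G" by (auto simp: contains_singular_def)
qed

lemma contains_singular_triangle_iff:
  "contains_singular F (complete_graph 3) \<longleftrightarrow> (\<exists>u v w. {u, v, w} \<subseteq> verts F \<and> distinct [u, v, w] \<and>
     {u, v} \<in> edges F \<and> {u, w} \<in> edges F \<and> {v, w} \<in> edges F \<and>
     constant_or_injective (degree F) {u, v, w})" (is "_ \<longleftrightarrow> ?R")
proof -
  have V: "verts (complete_graph 3) = {0, 1, 2}" by (auto simp: complete_graph_def)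
  have E: "edges (complete_graph 3) = {{0, 1}, {0, 2}, {1, 2}}"
  proof
    show "edges (complete_graph 3) \<subseteq> {{0, 1}, {0, 2}, {1, 2}}"
      by (auto simp: complete_graph_def numeral_3_eq_3 less_Suc_eq elim!: nsets2_E)
    show "{{0, 1}, {0, 2}, {1, 2}} \<subseteq> edges (complete_graph 3)"
      by (auto simp: complete_graph_def nsets_def)
  qed
  note iff = contains_singular_iff_embedding[OF simple_complete_graph, of F 3, unfolded V E]
  show ?thesis
  proof
    assume "contains_singular F (complete_graph 3)"
    then obtain f where "inj_on f {0, 1, 2::nat}" "f ` {0, 1, 2} \<subseteq> verts F"
      "\<forall>e\<in>{{0, 1}, {0, 2}, {1, 2}}. f ` e \<in> edges F" "constant_or_injective (degree F) (f ` {0, 1, 2})"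
      unfolding iff by blast
    then show ?R by (intro exI[of _ "f 0"] exI[of _ "f 1"] exI[of _ "f 2"]) auto
  next
    assume ?R
    then obtain u v w where *: "{u, v, w} \<subseteq> verts F" "distinct [u, v, w]"
     "{u, v} \<in> edges F" "{u, w} \<in> edges F" "{v, w} \<in> edges F"
     "constant_or_injective (degree F) {u, v, w}" by blast
    then show "contains_singular F (complete_graph 3)"
      unfolding iff by (intro exI[of _ "(!) [u, v, w]"]) (auto simp: inj_on_def)
  qed
qed

lemma contains_singular_claw_iff:
  "contains_singular F (complete_bipartite 1 3) \<longleftrightarrow> (\<exists>v x y z. {v, x, y, z} \<subseteq> verts F \<and>
     distinct [v, x, y, z] \<and> {v, x} \<in> edges F \<and> {v, y} \<in> edges F \<and> {v, z} \<in> edges F \<and>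
     constant_or_injective (degree F) {v, x, y, z})" (is "_ \<longleftrightarrow> ?R")
proof -
  have V: "verts (complete_bipartite 1 3) = {0, 1, 2, 3}" by (auto simp: complete_bipartite_def)
  have "i < 1 \<and> 1 \<le> j \<and> j < 1 + 3 \<longleftrightarrow> i = 0 \<and> j \<in> {1, 2, 3}" for i j :: nat by auto
  then have E: "edges (complete_bipartite 1 3) = {{0, 1}, {0, 2}, {0, 3}}"
    unfolding complete_bipartite_def snd_conv by (simp only:) auto
  note iff = contains_singular_iff_embedding[OF simple_complete_bipartite, of F 1 3, unfolded V E]
  show ?thesis
  proof
    assume "contains_singular F (complete_bipartite 1 3)"
    then obtain f where "inj_on f {0, 1, 2, 3::nat}" "f ` {0, 1, 2, 3} \<subseteq> verts F"
      "\<forall>e\<in>{{0, 1}, {0, 2}, {0, 3}}. f ` e \<in> edges F"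
      "constant_or_injective (degree F) (f ` {0, 1, 2, 3})"
      unfolding iff by blast
    then show ?R
      by (intro exI[of _ "f 0"] exI[of _ "f 1"] exI[of _ "f 2"] exI[of _ "f 3"]) auto
  next
    assume ?R
    then obtain v x y z where *: "{v, x, y, z} \<subseteq> verts F" "distinct [v, x, y, z]"
     "{v, x} \<in> edges F" "{v, y} \<in> edges F" "{v, z} \<in> edges F"
     "constant_or_injective (degree F) {v, x, y, z}" by blast
    then show "contains_singular F (complete_bipartite 1 3)"
      unfolding iff by (intro exI[of _ "(!) [v, x, y, z]"]) (auto simp: inj_on_def)
  qed
qed

section \<open>Colourings as symmetric relations\<close>

text \<open>Degrees expressed through an adjacency predicate, so that the combinatorial argument can be carried
  out for a symmetric relation on a vertex set instead of a set of doubletons.\<close>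

definition nbr_count :: "'a set \<Rightarrow> ('a \<Rightarrow> 'a \<Rightarrow> bool) \<Rightarrow> 'a \<Rightarrow> nat" where
  "nbr_count V r v = card {u \<in> V. r v u}"

text \<open>The colourings without a singular red triangle or a singular blue claw. The red graph is the
  complement of the blue one, and the blue degree serves for both colours, which is legitimate by
  \<open>degrees_complementary\<close> below.\<close>

locale singular_free =
  fixes V :: "'a set" and blue :: "'a \<Rightarrow> 'a \<Rightarrow> bool"
  assumes finite_V: "finite V"
    and blue_sym: "blue u v \<Longrightarrow> blue v u"
    and blue_irrefl: "\<not> blue v v"
    and no_red_triangle: "\<lbrakk>{u, v, w} \<subseteq> V; distinct [u, v, w];
       constant_or_injective (nbr_count V blue) {u, v, w}\<rbrakk> \<Longrightarrow> blue u v \<or> blue u w \<or> blue v w"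
    and no_blue_claw: "\<lbrakk>{v, x, y, z} \<subseteq> V; distinct [v, x, y, z];
       constant_or_injective (nbr_count V blue) {v, x, y, z}; blue v x; blue v y\<rbrakk> \<Longrightarrow> \<not> blue v z"

lemma degree_eq_nbr_count:
  assumes "simple_graph G"
  shows "degree G v = nbr_count (verts G) (\<lambda>u w. {u, w} \<in> edges G) v"
proof -
  have E: "\<exists>u w. e = {u, w} \<and> u \<noteq> w \<and> u \<in> verts G \<and> w \<in> verts G" if "e \<in> edges G" for e
  proof -
    have "e \<in> nsets (verts G) 2" using assms that by (auto simp: simple_graph_def)
    then show ?thesis by (rule nsets2_E) blast
  qed
  have "bij_betw (\<lambda>u. {v, u}) {u \<in> verts G. {v, u} \<in> edges G} {e \<in> edges G. v \<in> e}"
    unfolding bij_betw_def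
  proof
    show "inj_on (\<lambda>u. {v, u}) {u \<in> verts G. {v, u} \<in> edges G}"
      by (auto simp: inj_on_def doubleton_eq_iff)
    show "(\<lambda>u. {v, u}) ` {u \<in> verts G. {v, u} \<in> edges G} = {e \<in> edges G. v \<in> e}"
    proof
      show "{e \<in> edges G. v \<in> e} \<subseteq> (\<lambda>u. {v, u}) ` {u \<in> verts G. {v, u} \<in> edges G}"
      proof
        fix e assume e: "e \<in> {e \<in> edges G. v \<in> e}"
        then obtain u where "e = {v, u}" "u \<in> verts G" using E[of e] by (auto simp: insert_commute)
        then show "e \<in> (\<lambda>u. {v, u}) ` {u \<in> verts G. {v, u} \<in> edges G}" using e by auto
      qed
    qed auto
  qed
  from bij_betw_same_card[OF this] show ?thesis by (simp add: degree_def nbr_count_def)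
qed

lemma simple_host_graph: "simple_graph (host_graph m c i)"
  by (auto simp: simple_graph_def host_graph_def complete_graph_def)

lemma edge_complete_graph_iff:
  "{u, v} \<in> edges (complete_graph m) \<longleftrightarrow> u < m \<and> v < m \<and> u \<noteq> v"
  by (auto simp: complete_graph_def nsets_def card_insert_if)

lemma edge_host_graph_iff:
  "{u, v} \<in> edges (host_graph m c i) \<longleftrightarrow> u < m \<and> v < m \<and> u \<noteq> v \<and> c {u, v} = i"
  using edge_complete_graph_iff[of u v m] by (auto simp: host_graph_def)

lemma degrees_complementary:
  assumes c: "c \<in> edges (complete_graph m) \<rightarrow> {1, 2}" and v: "v < m"
  shows "degree (host_graph m c 1) v + degree (host_graph m c 2) v = m - 1"
proof -
  let ?A = "\<lambda>i. {u \<in> {..<m}. {v, u} \<in> edges (host_graph m c i)}"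
  have V: "verts (host_graph m c i) = {..<m}" for i by (simp add: host_graph_def)
  have "?A 1 \<union> ?A 2 = {..<m} - {v}"
    using c v edge_complete_graph_iff[of v _ m] by (auto simp: edge_host_graph_iff)
  moreover have "?A 1 \<inter> ?A 2 = {}" by (auto simp: edge_host_graph_iff)
  ultimately have "card (?A 1) + card (?A 2) = card ({..<m} - {v})"
    by (metis (no_types, lifting) card_Un_disjoint finite_Diff finite_Un finite_lessThan)
  then show ?thesis
    using v by (simp add: degree_eq_nbr_count[OF simple_host_graph] nbr_count_def V)
qed

text \<open>The bridge used for both bounds: it removes graphs, isomorphisms and red degrees from the problem.\<close>

lemma singular_free_iff:
  assumes c: "c \<in> edges (complete_graph m) \<rightarrow> {1, 2}"
  shows "contains_singular (host_graph m c 1) (complete_graph 3) \<or>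
         contains_singular (host_graph m c 2) (complete_bipartite 1 3) \<longleftrightarrow>
         \<not> singular_free {..<m} (\<lambda>u v. {u, v} \<in> edges (host_graph m c 2))"
proof -
  let ?b = "\<lambda>u v. {u, v} \<in> edges (host_graph m c 2)"
  have V: "verts (host_graph m c i) = {..<m}" for i by (simp add: host_graph_def)
  have deg2: "degree (host_graph m c 2) = nbr_count {..<m} ?b"
    using degree_eq_nbr_count[OF simple_host_graph] by (force simp: V)
  have deg1: "constant_or_injective (degree (host_graph m c 1)) S \<longleftrightarrow>
      constant_or_injective (nbr_count {..<m} ?b) S" if "S \<subseteq> {..<m}" for S
  proof -
    have "degree (host_graph m c 1) u = degree (host_graph m c 1) v \<longleftrightarrow>
        nbr_count {..<m} ?b u = nbr_count {..<m} ?b v" if "u \<in> S" "v \<in> S" for u v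
    proof -
      have "u < m" "v < m" using that \<open>S \<subseteq> {..<m}\<close> by auto
      then have "degree (host_graph m c 1) u + nbr_count {..<m} ?b u =
          degree (host_graph m c 1) v + nbr_count {..<m} ?b v"
        using degrees_complementary[OF c] by (simp add: deg2)
      then show ?thesis by (metis add_left_cancel add_right_cancel)
    qed
    then show ?thesis unfolding constant_or_injective_def inj_on_def by meson
  qed
  have red: "{u, v} \<in> edges (host_graph m c 1) \<longleftrightarrow> \<not> ?b u v" if "u < m" "v < m" "u \<noteq> v" for u v
    using that c edge_complete_graph_iff[of u v m] by (auto simp: edge_host_graph_iff)
  let ?T = "contains_singular (host_graph m c 1) (complete_graph 3)"
  let ?C = "contains_singular (host_graph m c 2) (complete_bipartite 1 3)"
  show ?thesis
  proof
    assume "?T \<or> ?C"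
    then show "\<not> singular_free {..<m} ?b"
    proof
      assume ?T
      then obtain u v w where t: "{u, v, w} \<subseteq> {..<m}" "distinct [u, v, w]"
        "{u, v} \<in> edges (host_graph m c 1)" "{u, w} \<in> edges (host_graph m c 1)"
        "{v, w} \<in> edges (host_graph m c 1)"
        "constant_or_injective (degree (host_graph m c 1)) {u, v, w}"
        unfolding contains_singular_triangle_iff V by (elim exE conjE)
      then have nb: "\<not> ?b u v" "\<not> ?b u w" "\<not> ?b v w" using red[of u v] red[of u w] red[of v w] by auto
      show ?thesis
      proof
        assume "singular_free {..<m} ?b"
        from singular_free.no_red_triangle[OF this t(1,2) t(6)[unfolded deg1[OF t(1)]]]
        show False using nb by blast
      qed
    next
      assume ?C
      then obtain v x y z where t: "{v, x, y, z} \<subseteq> {..<m}" "distinct [v, x, y, z]"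
        "?b v x" "?b v y" "?b v z" "constant_or_injective (degree (host_graph m c 2)) {v, x, y, z}"
        unfolding contains_singular_claw_iff V by (elim exE conjE)
      show ?thesis
      proof
        assume "singular_free {..<m} ?b"
        from singular_free.no_blue_claw[OF this t(1,2) t(6)[unfolded deg2] t(3,4)]
        show False using t(5) by blast
      qed
    qed
  next
    assume not_free: "\<not> singular_free {..<m} ?b"
    show "?T \<or> ?C"
    proof (rule ccontr)
      assume none: "\<not> (?T \<or> ?C)"
      have "singular_free {..<m} ?b"
      proof (rule singular_free.intro)
        show "?b v u" if "?b u v" for u v using that by (simp add: insert_commute)
        show "\<not> ?b u u" for u using edge_host_graph_iff[of u u m c 2] by blast
        show "?b u v \<or> ?b u w \<or> ?b v w"
          if t: "{u, v, w} \<subseteq> {..<m}" "distinct [u, v, w]"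
            "constant_or_injective (nbr_count {..<m} ?b) {u, v, w}" for u v w
        proof (rule ccontr)
          assume "\<not> ?thesis"
          then have "{u, v} \<in> edges (host_graph m c 1)" "{u, w} \<in> edges (host_graph m c 1)"
            "{v, w} \<in> edges (host_graph m c 1)"
            using red[of u v] red[of u w] red[of v w] t(1,2) by auto
          then have ?T
            unfolding contains_singular_triangle_iff V using t(1,2) t(3)[folded deg1[OF t(1)]]
            by (intro exI[of _ u] exI[of _ v] exI[of _ w] conjI)
          then show False using none by blast
        qed
        show "\<not> ?b v z"
          if t: "{v, x, y, z} \<subseteq> {..<m}" "distinct [v, x, y, z]"
            "constant_or_injective (nbr_count {..<m} ?b) {v, x, y, z}" "?b v x" "?b v y" for v x y z
        proof
          assume "?b v z"
          with t have ?C
            unfolding contains_singular_claw_iff V deg2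
            by (intro exI[of _ v] exI[of _ x] exI[of _ y] exI[of _ z] conjI)
          then show False using none by blast
        qed
      qed simp
      then show False using not_free by blast
    qed
  qed
qed

section \<open>Structure of colourings without singular triangles and claws\<close>

context singular_free
begin

abbreviation deg :: "'a \<Rightarrow> nat" where "deg \<equiv> nbr_count V blue"

definition cls :: "nat \<Rightarrow> 'a set" where "cls d = {v \<in> V. deg v = d}"

text \<open>The classes other than that of \<open>v\<close> in which \<open>v\<close> has at least one blue (red) neighbour; a class
  may belong to both sets.\<close>

definition blue_classes :: "'a \<Rightarrow> nat set" where
  "blue_classes v = deg ` {u \<in> V. blue v u} - {deg v}"

definition red_classes :: "'a \<Rightarrow> nat set" where
  "red_classes v = deg ` {u \<in> V. u \<noteq> v \<and> \<not> blue v u} - {deg v}"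

definition full_blue :: "nat \<Rightarrow> nat \<Rightarrow> bool" where
  "full_blue d e \<longleftrightarrow> (\<forall>u\<in>cls d. \<forall>w\<in>cls e. blue u w)"

lemma full_blue_sym: "full_blue d e \<Longrightarrow> full_blue e d"
  unfolding full_blue_def using blue_sym by blast

lemma finite_cls: "finite (cls d)"
  using finite_V by (simp add: cls_def)

lemma cls_disjoint: "p \<noteq> q \<Longrightarrow> cls p \<inter> cls q = {}"
  by (auto simp: cls_def)

lemma cls_nonempty: "d \<in> deg ` V \<Longrightarrow> \<exists>v. v \<in> cls d"
  by (auto simp: cls_def)

lemma blue_nbrs_le_2:
  assumes S: "S \<subseteq> V" "constant_or_injective deg S" and v: "v \<in> S"
  shows "card {u \<in> S. blue v u} \<le> 2"
proof (rule ccontr)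
  assume "\<not> ?thesis"
  then have "3 \<le> card {u \<in> S. blue v u}" by simp
  then obtain X where X: "X \<subseteq> {u \<in> S. blue v u}" "card X = 3"
    by (meson obtain_subset_with_card_n)
  then obtain x y z where xyz: "X = {x, y, z}" "x \<noteq> y" "x \<noteq> z" "y \<noteq> z"
    by (auto simp: card_3_iff)
  have sub: "{v, x, y, z} \<subseteq> S" and b: "blue v x" "blue v y" "blue v z"
    using X xyz v by auto
  have "distinct [v, x, y, z]" using xyz b blue_irrefl by auto
  then show False
    using no_blue_claw[of v x y z] b S sub constant_or_injective_mono[OF S(2) sub] by auto
qed

text \<open>All other red neighbours of \<open>v\<close> are blue neighbours of a given one \<open>x\<close>, since otherwise
  a red triangle would arise; and \<open>x\<close> has at most two blue neighbours.\<close>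

lemma red_nbrs_le_3:
  assumes S: "S \<subseteq> V" "constant_or_injective deg S" and v: "v \<in> S"
  shows "card {u \<in> S. u \<noteq> v \<and> \<not> blue v u} \<le> 3" (is "card ?X \<le> 3")
proof (cases "?X = {}")
  case False
  then obtain x where x: "x \<in> ?X" by blast
  have fin: "finite S" using S(1) finite_V by (rule finite_subset)
  have "?X - {x} \<subseteq> {u \<in> S. blue x u}"
  proof
    fix y assume y: "y \<in> ?X - {x}"
    then have sub: "{v, x, y} \<subseteq> S" "distinct [v, x, y]" using x v by auto
    then show "y \<in> {u \<in> S. blue x u}"
      using no_red_triangle[of v x y] x y S(1) constant_or_injective_mono[OF S(2) sub(1)]
      by auto
  qed
  then have "card (?X - {x}) \<le> card {u \<in> S. blue x u}" using fin by (intro card_mono) auto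
  also have "\<dots> \<le> 2" using blue_nbrs_le_2[OF S] x by blast
  finally show ?thesis using x fin by simp
next
  case True
  then show ?thesis by (metis card.empty zero_le)
qed

lemma card_split_at:
  assumes "S \<subseteq> V" "v \<in> S"
  shows "card S = 1 + card {u \<in> S. blue v u} + card {u \<in> S. u \<noteq> v \<and> \<not> blue v u}"
proof -
  have fin: "finite S" using assms(1) finite_V by (rule finite_subset)
  have "S = insert v ({u \<in> S. blue v u} \<union> {u \<in> S. u \<noteq> v \<and> \<not> blue v u})" (is "_ = insert v (?B \<union> ?R)")
    using assms blue_irrefl by auto
  then have "card S = card (insert v (?B \<union> ?R))" by simp
  also have "\<dots> = 1 + card (?B \<union> ?R)" using fin blue_irrefl by simp
  also have "card (?B \<union> ?R) = card ?B + card ?R" using fin by (intro card_Un_disjoint) auto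
  finally show ?thesis by simp
qed

lemma cls_constant: "cls d \<subseteq> V" "constant_or_injective deg (cls d)"
  by (auto simp: cls_def constant_or_injective_def)

lemma inner_degrees:
  assumes "v \<in> cls d"
  obtains \<beta> \<rho> where "\<beta> = card {u \<in> cls d. blue v u}" "card (cls d) = 1 + \<beta> + \<rho>" "\<beta> \<le> 2" "\<rho> \<le> 3"
  using card_split_at[OF cls_constant(1) assms] blue_nbrs_le_2[OF cls_constant assms]
    red_nbrs_le_3[OF cls_constant assms] by blast

lemma card_cls_le_6: "card (cls d) \<le> 6"
proof (cases "cls d = {}")
  case False
  then obtain v where "v \<in> cls d" by blast
  then show ?thesis by (rule inner_degrees) linarith
qed simp

text \<open>Picking one neighbour in each foreign class that is met turns statements about classes into
  statements about vertices of a rainbow set.\<close>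

lemma exists_transversal:
  assumes v: "v \<in> V" and A: "A \<subseteq> V"
  obtains X where "X \<subseteq> A" "deg ` X = deg ` A - {deg v}" "inj_on deg X" "v \<notin> X"
    "insert v X \<subseteq> V" "constant_or_injective deg (insert v X)"
proof -
  have "deg ` A - {deg v} \<subseteq> deg ` A" by blast
  then obtain X where X: "X \<subseteq> A" "inj_on deg X" "deg ` A - {deg v} = deg ` X"
    unfolding subset_image_inj by blast
  then have "deg v \<notin> deg ` X" by blast
  then show ?thesis using that[of X] X v A by (auto simp: constant_or_injective_def)
qed

lemma card_blue_classes:
  assumes v: "v \<in> V"
  shows "card (blue_classes v) \<le> 2"
proof -
  obtain X where X: "X \<subseteq> {u \<in> V. blue v u}" "deg ` X = blue_classes v" "inj_on deg X"
    "insert v X \<subseteq> V" "constant_or_injective deg (insert v X)"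
    unfolding blue_classes_def by (rule exists_transversal[OF v, of "{u \<in> V. blue v u}"]) auto
  have fin: "finite X" using X(4) finite_V by (meson finite_insert finite_subset)
  have "card (blue_classes v) = card X" using X by (metis card_image)
  also have "\<dots> \<le> card {u \<in> insert v X. blue v u}" using X(1) fin by (intro card_mono) auto
  also have "\<dots> \<le> 2" using X by (intro blue_nbrs_le_2) auto
  finally show ?thesis .
qed

lemma card_red_classes:
  assumes v: "v \<in> V"
  shows "card (red_classes v) \<le> 3"
proof -
  obtain X where X: "X \<subseteq> {u \<in> V. u \<noteq> v \<and> \<not> blue v u}" "deg ` X = red_classes v" "inj_on deg X"
    "insert v X \<subseteq> V" "constant_or_injective deg (insert v X)"
    unfolding red_classes_def
    by (rule exists_transversal[OF v, of "{u \<in> V. u \<noteq> v \<and> \<not> blue v u}"]) auto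
  have fin: "finite X" using X(4) finite_V by (meson finite_insert finite_subset)
  have "card (red_classes v) = card X" using X by (metis card_image)
  also have "\<dots> \<le> card {u \<in> insert v X. u \<noteq> v \<and> \<not> blue v u}" using X(1) fin by (intro card_mono) auto
  also have "\<dots> \<le> 3" using X by (intro red_nbrs_le_3) auto
  finally show ?thesis .
qed

lemma classes_finite: "finite (blue_classes v)" "finite (red_classes v)"
  using finite_V by (simp_all add: blue_classes_def red_classes_def)

lemma degrees_split_at:
  assumes "v \<in> V"
  shows "deg ` V = insert (deg v) (blue_classes v \<union> red_classes v)"
  using assms by (auto simp: blue_classes_def red_classes_def)

lemma deg_notin_classes: "deg v \<notin> blue_classes v" "deg v \<notin> red_classes v"
  by (auto simp: blue_classes_def red_classes_def)

lemma card_degrees_split_at: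
  assumes "v \<in> V"
  shows "card (deg ` V) = 1 + card (blue_classes v \<union> red_classes v)"
  using degrees_split_at[OF assms] deg_notin_classes classes_finite by simp

lemma card_degrees_le_6: "card (deg ` V) \<le> 6"
proof (cases "V = {}")
  case False
  then obtain v where v: "v \<in> V" by blast
  show ?thesis
    using card_degrees_split_at[OF v] card_blue_classes[OF v] card_red_classes[OF v]
      card_Un_le[of "blue_classes v" "red_classes v"] by linarith
qed simp

lemma card_V_eq_sum: "card V = (\<Sum>d\<in>deg ` V. card (cls d))"
proof -
  have "V = (\<Union>d\<in>deg ` V. cls d)" by (auto simp: cls_def)
  moreover have "card (\<Union>d\<in>deg ` V. cls d) = (\<Sum>d\<in>deg ` V. card (cls d))"
    using finite_V finite_cls by (intro card_UN_disjoint) (auto simp: cls_def)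
  ultimately show ?thesis by simp
qed

lemma no_rainbow_red_triangle:
  assumes "{u, v, w} \<subseteq> V" "distinct [deg u, deg v, deg w]" "\<not> blue u v" "\<not> blue u w"
  shows "blue v w"
proof -
  have "constant_or_injective deg {u, v, w}"
    using assms(2) by (simp add: constant_or_injective_def inj_on_def)
  then show ?thesis using no_red_triangle[of u v w] assms by auto
qed

text \<open>A vertex that sends no blue edge to two foreign classes forces all edges between these to be blue,
  since a red one would complete a rainbow red triangle. This is how the colours between classes
  become uniform.\<close>

lemma full_blue_if_common_red:
  assumes v: "v \<in> V" and pq: "p \<noteq> q" "p \<noteq> deg v" "q \<noteq> deg v"
    and red: "p \<notin> blue_classes v" "q \<notin> blue_classes v"
  shows "full_blue p q"
  unfolding full_blue_def
proof (intro ballI)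
  fix u w assume uw: "u \<in> cls p" "w \<in> cls q"
  then have "\<not> blue v u" "\<not> blue v w" using red pq by (auto simp: cls_def blue_classes_def)
  moreover have "{v, u, w} \<subseteq> V" "distinct [deg v, deg u, deg w]"
    using uw pq v by (auto simp: cls_def)
  ultimately show "blue u w" using no_rainbow_red_triangle by blast
qed

lemma full_blue_in_blue_classes:
  assumes "full_blue (deg v) d" "v \<in> V" "d \<in> deg ` V"
  shows "d \<in> blue_classes v" "d \<noteq> deg v"
proof -
  obtain w where w: "w \<in> cls d" using cls_nonempty[OF assms(3)] by blast
  have v: "v \<in> cls (deg v)" using assms(2) by (simp add: cls_def)
  show "d \<noteq> deg v" using assms(1) v blue_irrefl unfolding full_blue_def by blast
  moreover have "blue v w" using assms(1) v w unfolding full_blue_def by blast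
  ultimately show "d \<in> blue_classes v" using w by (auto simp: blue_classes_def cls_def)
qed

text \<open>As there are at most two blue classes, two known ones leave only red edges to all other classes.\<close>

lemma blue_classes_eq:
  assumes v: "v \<in> V" and "x \<in> blue_classes v" "y \<in> blue_classes v" "x \<noteq> y"
  shows "blue_classes v = {x, y}"
proof -
  have "{x, y} \<subseteq> blue_classes v" using assms by simp
  moreover have "card (blue_classes v) \<le> card {x, y}" using card_blue_classes[OF v] assms(4) by simp
  ultimately show ?thesis using classes_finite(1) by (metis card_seteq)
qed

text \<open>Classes are indexed by their blue degree, so the label \<open>p\<close> of a class equals the degree of each
  of its vertices. Here \<open>\<beta>\<close> and \<open>\<rho>\<close> are the numbers of blue and red neighbours that a vertex
  of the class has inside it.\<close>

lemma class_degree_formula: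
  assumes p: "p \<in> deg ` V" and xy: "x \<in> deg ` V" "y \<in> deg ` V" "x \<noteq> y"
    and fb: "full_blue p x" "full_blue p y"
  obtains \<beta> \<rho> where "p = \<beta> + card (cls x) + card (cls y)" "card (cls p) = 1 + \<beta> + \<rho>" "\<beta> \<le> 2" "\<rho> \<le> 3"
proof -
  obtain v where v: "v \<in> cls p" using cls_nonempty[OF p] by blast
  then have vV: "v \<in> V" and dv: "deg v = p" by (auto simp: cls_def)
  have bx: "x \<in> blue_classes v" "y \<in> blue_classes v" and ne: "x \<noteq> p" "y \<noteq> p"
    using full_blue_in_blue_classes[of v x] full_blue_in_blue_classes[of v y] fb vV dv xy by auto
  have B: "blue_classes v = {x, y}" using blue_classes_eq[OF vV bx xy(3)] .
  have "{u \<in> V. blue v u} = {u \<in> cls p. blue v u} \<union> cls x \<union> cls y" (is "_ = ?I \<union> _ \<union> _")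
  proof
    show "{u \<in> V. blue v u} \<subseteq> ?I \<union> cls x \<union> cls y"
    proof
      fix u assume u: "u \<in> {u \<in> V. blue v u}"
      then have "deg u \<in> insert p (blue_classes v)" by (auto simp: blue_classes_def dv)
      then show "u \<in> ?I \<union> cls x \<union> cls y" using u B by (auto simp: cls_def)
    qed
    show "?I \<union> cls x \<union> cls y \<subseteq> {u \<in> V. blue v u}"
      using fb v unfolding full_blue_def by (auto simp: cls_def)
  qed
  then have "p = card (?I \<union> cls x \<union> cls y)" using dv by (simp add: nbr_count_def)
  also have "\<dots> = card (?I \<union> cls x) + card (cls y)"
    using finite_V ne xy by (intro card_Un_disjoint) (auto simp: cls_def)
  also have "card (?I \<union> cls x) = card ?I + card (cls x)"
    using finite_V ne xy by (intro card_Un_disjoint) (auto simp: cls_def)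
  finally have "p = card ?I + card (cls x) + card (cls y)" .
  with v that show ?thesis by (metis inner_degrees)
qed

section \<open>Six degree classes\<close>

lemma top_two_of_three:
  fixes x y z :: nat
  assumes "x \<noteq> y" "x \<noteq> z" "y \<noteq> z" "x \<le> 3" "y \<le> 3" "z \<le> 3" "5 \<le> x + y + z"
  shows "{2, 3} \<subseteq> {x, y, z}"
  using assms by simp presburger

text \<open>The degrees in a group of three classes of total size \<open>A\<close> are \<open>A - 1 - \<rho>\<close> for three different values
  of \<open>\<rho> \<le> 3\<close>. Since the sizes are at most \<open>3 + \<rho>\<close>, a total of 29 requires \<open>\<rho>\<close> to take the values 2 and 3
  in both groups, whose sizes are then 14 or 15; so \<open>A - 3\<close>, \<open>A - 4\<close> and \<open>B - 3\<close>, \<open>B - 4\<close> overlap,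
  although all six degrees differ.\<close>

lemma two_triangles_sizes:
  fixes a b c d e f na nb nc nd ne nf :: nat
  assumes a: "a = \<beta>a + nb + nc" "na = 1 + \<beta>a + \<rho>a" "\<beta>a \<le> 2" "\<rho>a \<le> 3"
    and b: "b = \<beta>b + na + nc" "nb = 1 + \<beta>b + \<rho>b" "\<beta>b \<le> 2" "\<rho>b \<le> 3"
    and c: "c = \<beta>c + na + nb" "nc = 1 + \<beta>c + \<rho>c" "\<beta>c \<le> 2" "\<rho>c \<le> 3"
    and d: "d = \<beta>d + ne + nf" "nd = 1 + \<beta>d + \<rho>d" "\<beta>d \<le> 2" "\<rho>d \<le> 3"
    and e: "e = \<beta>e + nd + nf" "ne = 1 + \<beta>e + \<rho>e" "\<beta>e \<le> 2" "\<rho>e \<le> 3"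
    and f: "f = \<beta>f + nd + ne" "nf = 1 + \<beta>f + \<rho>f" "\<beta>f \<le> 2" "\<rho>f \<le> 3"
    and dist: "distinct [a, b, c, d, e, f]"
  shows "na + nb + nc + (nd + ne + nf) \<le> 28"
proof (rule ccontr)
  assume too_big: "\<not> ?thesis"
  define A where "A = na + nb + nc"
  define B where "B = nd + ne + nf"
  have AB: "A + B \<ge> 29" using too_big by (simp add: A_def B_def)
  have deg_A: "a + 1 + \<rho>a = A" "b + 1 + \<rho>b = A" "c + 1 + \<rho>c = A"
    and deg_B: "d + 1 + \<rho>d = B" "e + 1 + \<rho>e = B" "f + 1 + \<rho>f = B"
    using a b c d e f by (simp_all add: A_def B_def)
  have A: "A \<le> 9 + \<rho>a + \<rho>b + \<rho>c" and B: "B \<le> 9 + \<rho>d + \<rho>e + \<rho>f"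
    using a b c d e f by (simp_all add: A_def B_def)
  have neq: "a \<noteq> b" "a \<noteq> c" "b \<noteq> c" "d \<noteq> e" "d \<noteq> f" "e \<noteq> f" using dist by auto
  have dA: "\<rho>a \<noteq> \<rho>b" "\<rho>a \<noteq> \<rho>c" "\<rho>b \<noteq> \<rho>c" and dB: "\<rho>d \<noteq> \<rho>e" "\<rho>d \<noteq> \<rho>f" "\<rho>e \<noteq> \<rho>f"
    using neq deg_A deg_B by linarith+
  have "\<rho>a + \<rho>b + \<rho>c \<le> 6" "\<rho>d + \<rho>e + \<rho>f \<le> 6"
    using dA dB a(4) b(4) c(4) d(4) e(4) f(4) by linarith+
  with A B AB have bounds: "A \<le> 15" "B \<le> 15" "5 \<le> \<rho>a + \<rho>b + \<rho>c" "5 \<le> \<rho>d + \<rho>e + \<rho>f"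
    by linarith+
  have "{2, 3} \<subseteq> {\<rho>a, \<rho>b, \<rho>c}"
    by (rule top_two_of_three[OF dA a(4) b(4) c(4) bounds(3)])
  then have in_abc: "{A - 4, A - 3} \<subseteq> {a, b, c}" using deg_A by auto
  have "{2, 3} \<subseteq> {\<rho>d, \<rho>e, \<rho>f}"
    by (rule top_two_of_three[OF dB d(4) e(4) f(4) bounds(4)])
  then have in_def: "{B - 4, B - 3} \<subseteq> {d, e, f}" using deg_B by auto
  have disj: "{a, b, c} \<inter> {d, e, f} = {}" using dist by auto
  have "A = B \<or> A - 4 = B - 3 \<or> A - 3 = B - 4"
    using AB bounds(1,2) by linarith
  then have "{A - 4, A - 3} \<inter> {B - 4, B - 3} \<noteq> {}" by fastforce
  then show False using in_abc in_def disj by blast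
qed

text \<open>The bounds 2 and 3 on the numbers of blue and red classes seen by a vertex are attained and the two
  sets are disjoint, so every vertex sees each foreign class in one colour. Two vertices on opposite
  sides then determine all colours between classes.\<close>

lemma six_classes:
  assumes six: "card (deg ` V) = 6"
  shows "card V \<le> 28"
proof -
  have *: "blue_classes v \<inter> red_classes v = {} \<and> card (blue_classes v) = 2 \<and> card (red_classes v) = 3"
    if v: "v \<in> V" for v
  proof -
    have "card (blue_classes v) + card (red_classes v) =
        card (blue_classes v \<union> red_classes v) + card (blue_classes v \<inter> red_classes v)"
      by (rule card_Un_Int[OF classes_finite])
    moreover have "card (blue_classes v \<union> red_classes v) = 5"
      using six card_degrees_split_at[OF v] by simp
    ultimately have "card (blue_classes v \<inter> red_classes v) = 0 \<and> card (blue_classes v) = 2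
        \<and> card (red_classes v) = 3"
      using card_blue_classes[OF v] card_red_classes[OF v] by linarith
    then show ?thesis using classes_finite[of v] by simp
  qed
  have "V \<noteq> {}" using six by auto
  then obtain v where v: "v \<in> V" by blast
  define a where "a = deg v"
  obtain b c where bc: "blue_classes v = {b, c}" "b \<noteq> c"
    using *[OF v] by (auto simp: card_2_iff)
  obtain d e f where "def": "red_classes v = {d, e, f}" "d \<noteq> e" "d \<noteq> f" "e \<noteq> f"
    using *[OF v] by (auto simp: card_3_iff)
  have D: "deg ` V = {a, b, c, d, e, f}"
    using degrees_split_at[OF v] bc "def" by (auto simp: a_def)
  have dist: "distinct [a, b, c, d, e, f]"
    using *[OF v] bc "def" deg_notin_classes[of v] by (auto simp: a_def)
  have fb1: "full_blue d e" "full_blue d f" "full_blue e f"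
    using full_blue_if_common_red[OF v] bc dist by (auto simp: a_def)
  have "d \<in> deg ` V" using D by simp
  then obtain w where w: "w \<in> V" "deg w = d" by blast
  have "blue_classes w = {e, f}"
    using blue_classes_eq[OF w(1), of e f] full_blue_in_blue_classes(1)[of w] w fb1 D dist by auto
  then have fb2: "full_blue a b" "full_blue a c" "full_blue b c"
    using full_blue_if_common_red[OF w(1)] w(2) dist by auto
  note sym = fb1[THEN full_blue_sym] fb2[THEN full_blue_sym]
  let ?n = "\<lambda>i. card (cls i)"
  obtain \<beta>a \<rho>a where a: "a = \<beta>a + ?n b + ?n c" "?n a = 1 + \<beta>a + \<rho>a" "\<beta>a \<le> 2" "\<rho>a \<le> 3"
    using class_degree_formula[of a b c] fb2 sym D dist by auto
  obtain \<beta>b \<rho>b where b: "b = \<beta>b + ?n a + ?n c" "?n b = 1 + \<beta>b + \<rho>b" "\<beta>b \<le> 2" "\<rho>b \<le> 3"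
    using class_degree_formula[of b a c] fb2 sym D dist by auto
  obtain \<beta>c \<rho>c where c: "c = \<beta>c + ?n a + ?n b" "?n c = 1 + \<beta>c + \<rho>c" "\<beta>c \<le> 2" "\<rho>c \<le> 3"
    using class_degree_formula[of c a b] fb2 sym D dist by auto
  obtain \<beta>d \<rho>d where d: "d = \<beta>d + ?n e + ?n f" "?n d = 1 + \<beta>d + \<rho>d" "\<beta>d \<le> 2" "\<rho>d \<le> 3"
    using class_degree_formula[of d e f] fb1 sym D dist by auto
  obtain \<beta>e \<rho>e where e: "e = \<beta>e + ?n d + ?n f" "?n e = 1 + \<beta>e + \<rho>e" "\<beta>e \<le> 2" "\<rho>e \<le> 3"
    using class_degree_formula[of e d f] fb1 sym D dist by auto
  obtain \<beta>f \<rho>f where f: "f = \<beta>f + ?n d + ?n e" "?n f = 1 + \<beta>f + \<rho>f" "\<beta>f \<le> 2" "\<rho>f \<le> 3"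
    using class_degree_formula[of f d e] fb1 sym D dist by auto
  have "card V = ?n a + ?n b + ?n c + (?n d + ?n e + ?n f)"
    using card_V_eq_sum D dist by simp
  moreover have "?n a + ?n b + ?n c + (?n d + ?n e + ?n f) \<le> 28"
    by (rule two_triangles_sizes[OF a b c d e f dist])
  ultimately show ?thesis by simp
qed

section \<open>Five degree classes\<close>

text \<open>A vertex of \<open>e\<close> with a red neighbour in \<open>a \<union> b\<close> is completely blue to \<open>c \<union> d\<close>, because otherwise a
  rainbow red triangle would appear, and it has then used up its two blue classes. So \<open>e\<close> splits into
  \<open>X\<close>, joined in blue to \<open>a \<union> b\<close>, and \<open>Y\<close>, joined in blue to \<open>c \<union> d\<close>. If \<open>a\<close> and \<open>b\<close> both
  had size 6, both would have degree \<open>2 + 6 + |X|\<close>; the same holds for \<open>c\<close>, \<open>d\<close> and \<open>Y\<close>. One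
  vertex is therefore missing in each pair.\<close>

lemma five_classes_split:
  assumes D: "deg ` V = {a, b, c, d, e}" and dist: "distinct [a, b, c, d, e]"
    and fb: "full_blue a b" "full_blue c d"
    and red: "\<And>u w. u \<in> cls a \<union> cls b \<Longrightarrow> w \<in> cls c \<union> cls d \<Longrightarrow> \<not> blue u w"
  shows "card V \<le> 28"
proof -
  let ?n = "\<lambda>i. card (cls i)"
  define X where "X = {w \<in> cls e. \<forall>u\<in>cls a \<union> cls b. blue w u}"
  define Y where "Y = cls e - X"
  have dist_neq: "a \<noteq> b" "a \<noteq> c" "a \<noteq> d" "a \<noteq> e" "b \<noteq> c" "b \<noteq> d" "b \<noteq> e" "c \<noteq> d" "c \<noteq> e" "d \<noteq> e"
    using dist by auto
  have X_red: "\<not> blue w t" if w: "w \<in> X" and t: "t \<in> cls c \<union> cls d" for w t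
  proof
    assume blue: "blue w t"
    obtain u1 u2 where "u1 \<in> cls a" "u2 \<in> cls b" using cls_nonempty D by (metis insertCI)
    then have "{a, b, deg t} \<subseteq> blue_classes w"
      using w t blue dist_neq by (auto simp: X_def blue_classes_def cls_def)
    moreover have "card {a, b, deg t} = 3" using t dist_neq by (auto simp: cls_def)
    moreover have "w \<in> V" using w by (auto simp: X_def cls_def)
    ultimately show False
      using card_blue_classes[of w] card_mono[OF classes_finite(1), of "{a, b, deg t}" w] by simp
  qed
  have Y_blue: "blue w t" if w: "w \<in> Y" and t: "t \<in> cls c \<union> cls d" for w t
  proof -
    obtain u where u: "u \<in> cls a \<union> cls b" "\<not> blue w u" using w by (auto simp: X_def Y_def)
    have "\<not> blue u t" using red u t by blast
    moreover have "{u, w, t} \<subseteq> V" "distinct [deg u, deg w, deg t]"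
      using w u t dist_neq by (auto simp: Y_def cls_def)
    ultimately show ?thesis using no_rainbow_red_triangle[of u w t] u(2) blue_sym by blast
  qed
  have Y_red: "\<not> blue w t" if w: "w \<in> Y" and t: "t \<in> cls a \<union> cls b" for w t
  proof
    assume blue: "blue w t"
    obtain u1 u2 where "u1 \<in> cls c" "u2 \<in> cls d" using cls_nonempty D by (metis insertCI)
    then have "{c, d, deg t} \<subseteq> blue_classes w"
      using w t blue dist_neq Y_blue[OF w]
      by (auto simp: Y_def blue_classes_def cls_def)
    moreover have "card {c, d, deg t} = 3" using t dist_neq by (auto simp: cls_def)
    moreover have "w \<in> V" using w by (auto simp: Y_def cls_def)
    ultimately show False
      using card_blue_classes[of w] card_mono[OF classes_finite(1), of "{c, d, deg t}" w] by simp
  qed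
  have V: "t \<in> cls a \<union> cls b \<union> cls c \<union> cls d \<union> cls e" if "t \<in> V" for t
  proof -
    have "deg t \<in> {a, b, c, d, e}" using that D by blast
    then show ?thesis using that by (simp add: cls_def)
  qed
  have e: "X \<union> Y = cls e" "X \<inter> Y = {}" by (auto simp: X_def Y_def)
  have X_e: "X \<subseteq> cls e" and Y_e: "Y \<subseteq> cls e" using e by auto
  \<comment> \<open>The 2 is the blue degree inside a class of size 6, where at most two blue and three red neighbours
      have to account for the five other vertices.\<close>
  have deg_eq: "p = 2 + ?n q + card Z"
    if six: "?n p = 6" and fb: "full_blue p q" and neq: "p \<noteq> q" "p \<noteq> e" "q \<noteq> e"
      and nb: "\<And>u. u \<in> cls p \<Longrightarrow> {t \<in> V. blue u t} \<subseteq> cls p \<union> cls q \<union> Z"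
      and Z: "Z \<subseteq> cls e" "\<And>u t. u \<in> cls p \<Longrightarrow> t \<in> Z \<Longrightarrow> blue u t" for p q Z
  proof -
    obtain u where u: "u \<in> cls p" using six by fastforce
    let ?I = "{t \<in> cls p. blue u t}"
    have nbrs: "{t \<in> V. blue u t} = ?I \<union> cls q \<union> Z"
    proof
      show "{t \<in> V. blue u t} \<subseteq> ?I \<union> cls q \<union> Z" using nb[OF u] by blast
      have "blue u t" if "t \<in> cls q" for t using that u fb unfolding full_blue_def by blast
      moreover have "cls p \<subseteq> V" "cls q \<subseteq> V" "Z \<subseteq> V" using cls_constant(1) Z(1) by blast+
      ultimately show "?I \<union> cls q \<union> Z \<subseteq> {t \<in> V. blue u t}" using Z(2)[OF u] by blast
    qed
    have disj: "?I \<inter> cls q = {}" "(?I \<union> cls q) \<inter> Z = {}"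
      using cls_disjoint[of p q] cls_disjoint[of p e] cls_disjoint[of q e] neq Z(1) by blast+
    have fin: "finite ?I" "finite Z" using finite_cls Z(1) by (auto intro: finite_subset)
    have "deg u = p" using u by (simp add: cls_def)
    then have "p = card (?I \<union> cls q \<union> Z)" using nbrs by (simp add: nbr_count_def)
    also have "\<dots> = card (?I \<union> cls q) + card Z"
      using fin finite_cls disj(2) by (intro card_Un_disjoint) auto
    also have "card (?I \<union> cls q) = card ?I + ?n q"
      using fin finite_cls disj(1) by (intro card_Un_disjoint) auto
    also have "card ?I = 2" by (rule inner_degrees[OF u]) (use six in linarith)
    finally show ?thesis .
  qed
  have "\<not> (?n a = 6 \<and> ?n b = 6)"
  proof
    assume *: "?n a = 6 \<and> ?n b = 6"
    have nb: "{t \<in> V. blue u t} \<subseteq> cls a \<union> cls b \<union> X" if u: "u \<in> cls a \<union> cls b" for u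
    proof
      fix t assume t: "t \<in> {t \<in> V. blue u t}"
      then have "t \<notin> cls c \<union> cls d" using red[OF u] by blast
      moreover have "t \<notin> Y" using Y_red[OF _ u] blue_sym[of u t] t by blast
      ultimately show "t \<in> cls a \<union> cls b \<union> X" using V[of t] t e(1) by blast
    qed
    have bX: "blue u t" if "u \<in> cls a \<union> cls b" "t \<in> X" for u t
      using that blue_sym by (auto simp: X_def)
    have "a = 2 + 6 + card X"
      using deg_eq[of a b X, OF _ fb(1) _ _ _ _ X_e] * dist_neq nb bX by auto
    moreover have "b = 2 + 6 + card X"
      using deg_eq[of b a X, OF _ full_blue_sym[OF fb(1)] _ _ _ _ X_e] * dist_neq nb bX by auto
    ultimately show False using dist_neq by simp
  qed
  moreover have "\<not> (?n c = 6 \<and> ?n d = 6)"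
  proof
    assume *: "?n c = 6 \<and> ?n d = 6"
    have nb: "{t \<in> V. blue u t} \<subseteq> cls c \<union> cls d \<union> Y" if u: "u \<in> cls c \<union> cls d" for u
    proof
      fix t assume t: "t \<in> {t \<in> V. blue u t}"
      then have "t \<notin> cls a \<union> cls b" using red[OF _ u] blue_sym[of u t] by blast
      moreover have "t \<notin> X" using X_red[OF _ u] blue_sym[of u t] t by blast
      ultimately show "t \<in> cls c \<union> cls d \<union> Y" using V[of t] t e(1) by blast
    qed
    have bY: "blue u t" if "u \<in> cls c \<union> cls d" "t \<in> Y" for u t
      using that blue_sym Y_blue by blast
    have "c = 2 + 6 + card Y"
      using deg_eq[of c d Y, OF _ fb(2) _ _ _ _ Y_e] * dist_neq nb bY by auto
    moreover have "d = 2 + 6 + card Y"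
      using deg_eq[of d c Y, OF _ full_blue_sym[OF fb(2)] _ _ _ _ Y_e] * dist_neq nb bY by auto
    ultimately show False using dist_neq by simp
  qed
  moreover have "card V = ?n a + ?n b + ?n c + ?n d + ?n e"
    using card_V_eq_sum D dist by simp
  ultimately show ?thesis
    using card_cls_le_6[of a] card_cls_le_6[of b] card_cls_le_6[of c] card_cls_le_6[of d]
      card_cls_le_6[of e] by linarith
qed

text \<open>The sizes and degrees of the blow-up of a 5-cycle \<open>a, b, e, d, c\<close>. With a total of 29 at least four
  classes have size 6; the two classes that are not neighbours of the remaining one then both have
  degree 14.\<close>

lemma five_cycle_sizes:
  fixes a b c d e na nb nc nd ne :: nat
  assumes "na = 6 \<longrightarrow> a = 2 + nb + nc" "nb = 6 \<longrightarrow> b = 2 + na + ne" "nc = 6 \<longrightarrow> c = 2 + na + nd"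
    "nd = 6 \<longrightarrow> d = 2 + nc + ne" "ne = 6 \<longrightarrow> e = 2 + nb + nd"
    and "na \<le> 6" "nb \<le> 6" "nc \<le> 6" "nd \<le> 6" "ne \<le> 6"
    and "a \<noteq> b" "a \<noteq> c" "b \<noteq> e" "c \<noteq> d" "d \<noteq> e"
  shows "na + nb + nc + nd + ne \<le> 28"
proof (rule ccontr)
  assume "\<not> ?thesis"
  then have "na = 6 \<or> nb = 6" "na = 6 \<or> nc = 6" "na = 6 \<or> nd = 6" "na = 6 \<or> ne = 6" "nb = 6 \<or> nc = 6"
    "nb = 6 \<or> nd = 6" "nb = 6 \<or> ne = 6" "nc = 6 \<or> nd = 6" "nc = 6 \<or> ne = 6" "nd = 6 \<or> ne = 6"
    using assms(6-10) by linarith+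
  moreover have "\<not> (nb = 6 \<and> nc = 6 \<and> nd = 6 \<and> ne = 6)" "\<not> (na = 6 \<and> nc = 6 \<and> nd = 6 \<and> ne = 6)"
    "\<not> (na = 6 \<and> nb = 6 \<and> nd = 6 \<and> ne = 6)" "\<not> (na = 6 \<and> nb = 6 \<and> nc = 6 \<and> ne = 6)"
    "\<not> (na = 6 \<and> nb = 6 \<and> nc = 6 \<and> nd = 6)"
    using assms(1-5,11-15) by auto
  ultimately show False by blast
qed

text \<open>The single blue edge between the pairs \<open>ab\<close> and \<open>cd\<close> gives each of its ends the second and last
  class it can be blue to; the classes that remain red to it then form the blue pairs
  \<open>de\<close> and \<open>be\<close>. Now \<open>e\<close> is blue to \<open>b\<close> and \<open>d\<close> as well, so \<open>a\<close> and \<open>c\<close> are a blue pair,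
  which closes the cycle.\<close>

lemma five_classes_cycle:
  assumes D: "deg ` V = {a, b, c, d, e}" and dist: "distinct [a, b, c, d, e]"
    and fb: "full_blue a b" "full_blue c d"
    and uw: "u \<in> cls a" "w \<in> cls c" "blue u w"
  shows "card V \<le> 28"
proof -
  have dist_neq: "a \<noteq> b" "a \<noteq> c" "a \<noteq> d" "a \<noteq> e" "b \<noteq> c" "b \<noteq> d" "b \<noteq> e" "c \<noteq> d" "c \<noteq> e" "d \<noteq> e"
    using dist by auto
  have V: "u \<in> V" "w \<in> V" "deg u = a" "deg w = c" using uw by (auto simp: cls_def)
  have "b \<in> blue_classes u" "c \<in> blue_classes u"
    using full_blue_in_blue_classes[of u b] fb V uw D dist_neq by (auto simp: blue_classes_def)
  then have "blue_classes u = {b, c}" using blue_classes_eq V dist_neq by blast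
  then have de: "full_blue d e"
    using full_blue_if_common_red[OF V(1), of d e] V dist_neq by auto
  have "d \<in> blue_classes w" "a \<in> blue_classes w"
    using full_blue_in_blue_classes[of w d] fb V uw(3) blue_sym D dist_neq
    by (auto simp: blue_classes_def image_iff)
  then have "blue_classes w = {d, a}" using blue_classes_eq V dist_neq by blast
  then have be: "full_blue b e"
    using full_blue_if_common_red[OF V(2), of b e] V dist_neq by auto
  have "e \<in> deg ` V" using D by simp
  then obtain t where t: "t \<in> V" "deg t = e" by blast
  have "b \<in> blue_classes t" "d \<in> blue_classes t"
    using full_blue_in_blue_classes(1)[of t] t de be full_blue_sym D by auto
  then have "blue_classes t = {b, d}" using blue_classes_eq t dist_neq by blast
  then have ac: "full_blue a c"
    using full_blue_if_common_red[OF t(1), of a c] t dist_neq by auto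
  note all = fb de be ac
  note all = all all[THEN full_blue_sym]
  let ?n = "\<lambda>i. card (cls i)"
  have deg_eq: "p = 2 + ?n x + ?n y"
    if "?n p = 6" "p \<in> deg ` V" "x \<in> deg ` V" "y \<in> deg ` V" "x \<noteq> y" "full_blue p x" "full_blue p y" for p x y
    by (rule class_degree_formula[of p x y]) (use that in auto)
  have card_V: "card V = ?n a + ?n b + ?n c + ?n d + ?n e"
    using card_V_eq_sum D dist by simp
  have memb: "a \<in> deg ` V" "b \<in> deg ` V" "c \<in> deg ` V" "d \<in> deg ` V" "e \<in> deg ` V"
    unfolding D by simp_all
  have e1: "?n a = 6 \<longrightarrow> a = 2 + ?n b + ?n c"
    by (rule impI, rule deg_eq, assumption) (rule memb dist_neq all)+
  have e2: "?n b = 6 \<longrightarrow> b = 2 + ?n a + ?n e"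
    by (rule impI, rule deg_eq, assumption) (rule memb dist_neq all)+
  have e3: "?n c = 6 \<longrightarrow> c = 2 + ?n a + ?n d"
    by (rule impI, rule deg_eq, assumption) (rule memb dist_neq all)+
  have e4: "?n d = 6 \<longrightarrow> d = 2 + ?n c + ?n e"
    by (rule impI, rule deg_eq, assumption) (rule memb dist_neq all)+
  have e5: "?n e = 6 \<longrightarrow> e = 2 + ?n b + ?n d"
    by (rule impI, rule deg_eq, assumption) (rule memb dist_neq all)+
  have "?n a + ?n b + ?n c + ?n d + ?n e \<le> 28"
    by (rule five_cycle_sizes[OF e1 e2 e3 e4 e5]) (fact card_cls_le_6 dist_neq)+
  then show ?thesis using card_V by simp
qed

text \<open>Each vertex sends no blue edge to some two foreign classes, which therefore form a blue pair. A vertex \<open>w\<close>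
  in the first such pair \<open>ab\<close> has a blue edge to the other class of that pair, so the pair that it
  yields is disjoint from \<open>ab\<close>.\<close>

lemma five_classes:
  assumes five: "card (deg ` V) = 5"
  shows "card V \<le> 28"
proof -
  \<comment> \<open>Of the four foreign classes at most two receive blue edges from \<open>v\<close>.\<close>
  have red_pair: "\<exists>p q. p \<noteq> q \<and> {p, q} \<subseteq> deg ` V - insert (deg v) (blue_classes v) \<and> full_blue p q"
    if v: "v \<in> V" for v
  proof -
    have "card (insert (deg v) (blue_classes v)) \<le> 3"
      using card_blue_classes[OF v] card_insert_le_m1[of 3 "blue_classes v" "deg v"]
      by (simp add: card_insert_if classes_finite)
    then have "2 \<le> card (deg ` V - insert (deg v) (blue_classes v))"
      using diff_card_le_card_Diff[of "insert (deg v) (blue_classes v)" "deg ` V"] five classes_finite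
      by simp
    then obtain P where "P \<subseteq> deg ` V - insert (deg v) (blue_classes v)" "card P = 2"
      by (meson obtain_subset_with_card_n)
    then obtain p q where "p \<noteq> q" "{p, q} \<subseteq> deg ` V - insert (deg v) (blue_classes v)"
      by (auto simp: card_2_iff)
    then show ?thesis using full_blue_if_common_red[OF v, of p q] by blast
  qed
  have "V \<noteq> {}" using five by auto
  then obtain v where v: "v \<in> V" by blast
  obtain a b where ab: "a \<noteq> b" "{a, b} \<subseteq> deg ` V" "full_blue a b"
    using red_pair[OF v] by blast
  then obtain w where w: "w \<in> V" "deg w = a" by blast
  obtain c d where cd: "c \<noteq> d" "{c, d} \<subseteq> deg ` V - insert (deg w) (blue_classes w)" "full_blue c d"
    using red_pair[OF w(1)] by blast
  have "b \<in> blue_classes w" using full_blue_in_blue_classes[of w b] ab w by auto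
  then have dist4: "distinct [a, b, c, d]" using ab cd w by auto
  have "{a, b, c, d} \<subseteq> deg ` V" using ab cd by blast
  moreover have "card {a, b, c, d} = 4" using dist4 by simp
  ultimately have "card (deg ` V - {a, b, c, d}) = 1" using five by (subst card_Diff_subset) auto
  then obtain e where e: "deg ` V - {a, b, c, d} = {e}" by (auto simp: card_1_singleton_iff)
  then have D: "deg ` V = {a, b, c, d, e}" using \<open>{a, b, c, d} \<subseteq> deg ` V\<close> by blast
  have dist: "distinct [a, b, c, d, e]" using dist4 e by auto
  show ?thesis
  proof (cases "\<exists>u \<in> cls a \<union> cls b. \<exists>w \<in> cls c \<union> cls d. blue u w")
    case False
    then show ?thesis using five_classes_split[OF D dist ab(3) cd(3)] by blast
  next
    case True
    then obtain u w where uw: "u \<in> cls a \<union> cls b" "w \<in> cls c \<union> cls d" "blue u w" by blast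
    have cycle: "card V \<le> 28"
      if "{a', b'} = {a, b}" "{c', d'} = {c, d}" "full_blue a' b'" "full_blue c' d'"
        "u \<in> cls a'" "w \<in> cls c'" for a' b' c' d'
    proof (rule five_classes_cycle[of a' b' c' d' e u w])
      show "deg ` V = {a', b', c', d', e}" using D that(1,2) by (simp add: doubleton_eq_iff) blast
      show "distinct [a', b', c', d', e]" using dist that(1,2) by (auto simp: doubleton_eq_iff)
    qed (use that uw in auto)
    show ?thesis
      using uw(1,2) cycle[of a b c d] cycle[of b a c d] cycle[of a b d c] cycle[of b a d c]
        ab(3) cd(3) full_blue_sym by (auto simp: insert_commute)
  qed
qed

lemma card_V_le_28: "card V \<le> 28"
proof -
  have "card V \<le> 6 * card (deg ` V)"
    using sum_bounded_above[of "deg ` V" "\<lambda>d. card (cls d)" 6] card_cls_le_6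
    by (simp add: card_V_eq_sum mult.commute)
  then consider "card V \<le> 28" | "card (deg ` V) = 5" | "card (deg ` V) = 6"
    using card_degrees_le_6 by linarith
  then show ?thesis using five_classes six_classes by cases
qed

end

section \<open>A colouring on 28 vertices\<close>

text \<open>The classes are the intervals starting at 0, 6, 11, 17 and 22. Between classes an edge is blue iff its
  ends lie on the same side; the last class has two vertices on the first side and four on the
  second. Inside a class of size 6 equal parity is blue, which gives two triangles; inside a class of
  size 5 the blue edges form a 5-cycle of consecutive numbers.\<close>

definition witness_class :: "nat \<Rightarrow> nat" where
  "witness_class v = (if v < 6 then 0 else if v < 11 then 1 else if v < 17 then 2 else if v < 22 then 3 else 4)"

definition witness_side :: "nat \<Rightarrow> bool" where
  "witness_side v \<longleftrightarrow> v < 11 \<or> v = 22 \<or> v = 23"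

definition witness_inner :: "nat \<Rightarrow> nat \<Rightarrow> bool" where
  "witness_inner u v \<longleftrightarrow> (if witness_class u \<in> {1, 3} then (u + 1 = v \<or> v + 1 = u \<or> u + 4 = v \<or> v + 4 = u)
     else even u = even v)"

definition witness_blue :: "nat \<Rightarrow> nat \<Rightarrow> bool" where
  "witness_blue u v \<longleftrightarrow> u < 28 \<and> v < 28 \<and> u \<noteq> v \<and>
    (if witness_class u = witness_class v then witness_inner u v else witness_side u = witness_side v)"

lemma nbr_count_filter: "nbr_count {..<n} r v = length (filter (r v) [0..<n])"
proof -
  have "{u \<in> {..<n}. r v u} = set (filter (r v) [0..<n])" by auto
  then show ?thesis unfolding nbr_count_def by (simp only: distinct_card distinct_filter distinct_upt)
qed

lemma witness_degree_list: "\<forall>v\<in>set [0..<28]. length (filter (witness_blue v) [0..<28]) = 9 + witness_class v"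
  by code_simp

lemma witness_degree:
  assumes "v < 28"
  shows "nbr_count {..<28} witness_blue v = 9 + witness_class v"
proof -
  have "v \<in> set [0..<28]" using assms unfolding set_upt by simp
  from witness_degree_list[rule_format, OF this] show ?thesis unfolding nbr_count_filter .
qed

lemma witness_inner_degree_list:
  "\<forall>v\<in>set [0..<28]. length (filter (\<lambda>u. witness_blue v u \<and> witness_class u = witness_class v) [0..<28]) = 2"
  by code_simp

lemma witness_inner_degree:
  assumes "v < 28"
  shows "nbr_count {..<28} (\<lambda>v u. witness_blue v u \<and> witness_class u = witness_class v) v = 2"
proof -
  have "v \<in> set [0..<28]" using assms unfolding set_upt by simp
  from witness_inner_degree_list[rule_format, OF this] show ?thesis unfolding nbr_count_filter .
qed

lemma witness_class_red_triangle_list: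
  "\<forall>u\<in>set [0..<28]. \<forall>v\<in>set (filter (\<lambda>v. u \<noteq> v \<and> witness_class u = witness_class v \<and> \<not> witness_blue u v) [0..<28]).
    \<forall>w\<in>set (filter (\<lambda>w. u \<noteq> w \<and> witness_class u = witness_class w \<and> \<not> witness_blue u w) [0..<28]). v = w \<or> witness_blue v w"
  by code_simp

lemma witness_class_no_red_triangle:
  assumes "u < 28" "v < 28" "w < 28" "distinct [u, v, w]" "witness_class u = witness_class v" "witness_class u = witness_class w"
  shows "witness_blue u v \<or> witness_blue u w \<or> witness_blue v w"
proof (rule ccontr)
  assume no: "\<not> ?thesis"
  have u: "u \<in> set [0..<28]" using assms unfolding set_upt by simp
  have v: "v \<in> set (filter (\<lambda>v. u \<noteq> v \<and> witness_class u = witness_class v \<and> \<not> witness_blue u v) [0..<28])"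
    using assms no unfolding set_filter set_upt by simp
  have w: "w \<in> set (filter (\<lambda>w. u \<noteq> w \<and> witness_class u = witness_class w \<and> \<not> witness_blue u w) [0..<28])"
    using assms no unfolding set_filter set_upt by simp
  from witness_class_red_triangle_list[rule_format, OF u v w] show False using assms(4) no by simp
qed

lemma side_classes: "witness_class v \<in> (if witness_side v then {0, 1, 4} else {2, 3, 4})"
  by (simp add: witness_class_def witness_side_def)

text \<open>Each side meets only three classes, so a rainbow blue claw does not fit on it; and of three vertices
  two always lie on the same side, so there is no rainbow red triangle either.\<close>

lemma no_rainbow_on_side:
  assumes "witness_side x = witness_side v" "witness_side y = witness_side v" "witness_side z = witness_side v"
    and "distinct [witness_class v, witness_class x, witness_class y, witness_class z]"
  shows False
  using side_classes[of v] side_classes[of x] side_classes[of y] side_classes[of z] assms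
  by (auto split: if_splits)

lemma singular_free_28: "singular_free {..<28} witness_blue"
proof (rule singular_free.intro)
  show "witness_blue v u" if "witness_blue u v" for u v
    using that unfolding witness_blue_def witness_inner_def by metis
  show "\<not> witness_blue v v" for v by (simp add: witness_blue_def)
  have deg_iff: "constant_or_injective (nbr_count {..<28} witness_blue) S \<longleftrightarrow>
      (\<forall>u\<in>S. \<forall>v\<in>S. witness_class u = witness_class v) \<or> inj_on witness_class S" if S: "S \<subseteq> {..<28}" for S
  proof -
    have "nbr_count {..<28} witness_blue u = nbr_count {..<28} witness_blue v \<longleftrightarrow> witness_class u = witness_class v"
      if "u \<in> S" "v \<in> S" for u v
    proof -
      have "u < 28" "v < 28" using that S by auto
      then show ?thesis by (simp add: witness_degree)
    qed
    then show ?thesis unfolding constant_or_injective_def inj_on_def by (simp cong: ball_cong)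
  qed
  show "witness_blue u v \<or> witness_blue u w \<or> witness_blue v w"
    if "{u, v, w} \<subseteq> {..<28}" "distinct [u, v, w]"
      "constant_or_injective (nbr_count {..<28} witness_blue) {u, v, w}" for u v w
    using that(3) unfolding deg_iff[OF that(1)]
  proof
    assume "\<forall>a\<in>{u, v, w}. \<forall>b\<in>{u, v, w}. witness_class a = witness_class b"
    then have "witness_class u = witness_class v" "witness_class u = witness_class w" by blast+
    moreover have "u < 28" "v < 28" "w < 28" using that(1) by auto
    ultimately show ?thesis using witness_class_no_red_triangle that(2) by blast
  next
    assume "inj_on witness_class {u, v, w}"
    then have "witness_class u \<noteq> witness_class v" "witness_class u \<noteq> witness_class w" "witness_class v \<noteq> witness_class w"
      using that(2) by (auto simp: inj_on_def)
    moreover have "witness_side u = witness_side v \<or> witness_side u = witness_side w \<or> witness_side v = witness_side w" by blast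
    moreover have "u < 28" "v < 28" "w < 28" using that(1) by auto
    ultimately show ?thesis using that(2) unfolding witness_blue_def by auto
  qed
  show "\<not> witness_blue v z"
    if "{v, x, y, z} \<subseteq> {..<28}" "distinct [v, x, y, z]"
      "constant_or_injective (nbr_count {..<28} witness_blue) {v, x, y, z}" "witness_blue v x" "witness_blue v y"
    for v x y z
  proof
    assume "witness_blue v z"
    from that(3) show False unfolding deg_iff[OF that(1)]
    proof
      assume const: "\<forall>a\<in>{v, x, y, z}. \<forall>b\<in>{v, x, y, z}. witness_class a = witness_class b"
      have "witness_class x = witness_class v" "witness_class y = witness_class v" "witness_class z = witness_class v" using const by blast+
      then have "{x, y, z} \<subseteq> {u \<in> {..<28}. witness_blue v u \<and> witness_class u = witness_class v}"
        using that(1,4,5) \<open>witness_blue v z\<close> by blast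
      then have "card {x, y, z} \<le> card {u \<in> {..<28}. witness_blue v u \<and> witness_class u = witness_class v}"
        by (intro card_mono) simp_all
      also have "\<dots> = 2" using witness_inner_degree[of v] that(1) by (simp add: nbr_count_def)
      finally have "card {x, y, z} \<le> 2" .
      then show False using that(2) by simp
    next
      assume "inj_on witness_class {v, x, y, z}"
      then have rainbow: "distinct [witness_class v, witness_class x, witness_class y, witness_class z]"
        using that(2) by (auto simp: inj_on_def)
      then have "witness_side x = witness_side v" "witness_side y = witness_side v" "witness_side z = witness_side v"
        using that(4,5) \<open>witness_blue v z\<close> unfolding witness_blue_def by auto
      then show False using rainbow by (rule no_rainbow_on_side)
    qed
  qed
qed simp

lemma no_property_28: "\<not> singular_ramsey_property (complete_graph 3) (complete_bipartite 1 3) 28"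
proof
  assume ramsey: "singular_ramsey_property (complete_graph 3) (complete_bipartite 1 3) 28"
  define c :: "nat set \<Rightarrow> nat" where "c e = (if \<exists>u v. e = {u, v} \<and> witness_blue u v then 2 else 1)" for e
  have c: "c \<in> edges (complete_graph 28) \<rightarrow> {1, 2}" by (auto simp: c_def)
  have "c {u, v} = 2 \<longleftrightarrow> witness_blue u v" for u v
    using singular_free.blue_sym[OF singular_free_28] by (auto simp: c_def doubleton_eq_iff)
  then have "(\<lambda>u v. {u, v} \<in> edges (host_graph 28 c 2)) = witness_blue"
    unfolding edge_host_graph_iff by (intro ext) (auto simp: witness_blue_def)
  then have "\<not> (contains_singular (host_graph 28 c 1) (complete_graph 3) \<or>
      contains_singular (host_graph 28 c 2) (complete_bipartite 1 3))"
    using singular_free_iff[OF c] singular_free_28 by simp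
  moreover have "\<forall>c \<in> edges (complete_graph 28) \<rightarrow> {1, 2}.
      contains_singular (host_graph 28 c 1) (complete_graph 3) \<or>
      contains_singular (host_graph 28 c 2) (complete_bipartite 1 3)"
    using ramsey unfolding singular_ramsey_property_def by simp
  ultimately show False using c by blast
qed

section \<open>The Ramsey number\<close>

lemma property_29: "singular_ramsey_property (complete_graph 3) (complete_bipartite 1 3) 29"
  unfolding singular_ramsey_property_def
proof (intro allI impI ballI)
  fix m :: nat and c :: "nat set \<Rightarrow> nat"
  assume "29 \<le> m" and c: "c \<in> edges (complete_graph m) \<rightarrow> {1, 2}"
  then have "\<not> singular_free {..<m} (\<lambda>u v. {u, v} \<in> edges (host_graph m c 2))"
    using singular_free.card_V_le_28[of "{..<m}"] by fastforce
  then show "contains_singular (host_graph m c 1) (complete_graph 3) \<or>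
      contains_singular (host_graph m c 2) (complete_bipartite 1 3)"
    using singular_free_iff[OF c] by blast
qed

theorem theorem28:
  shows "Rs (complete_graph 3) (complete_bipartite 1 3) = 29"
  unfolding Rs_def
proof (rule Least_equality)
  show "singular_ramsey_property (complete_graph 3) (complete_bipartite 1 3) 29"
    by (rule property_29)
  show "29 \<le> N" if "singular_ramsey_property (complete_graph 3) (complete_bipartite 1 3) N" for N
  proof (rule ccontr)
    assume "\<not> 29 \<le> N"
    then have "singular_ramsey_property (complete_graph 3) (complete_bipartite 1 3) 28"
      using that unfolding singular_ramsey_property_def by simp
    then show False using no_property_28 by blast
  qed
qed

end
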